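(* Let $L$ be a frame and $X$ its Priestley space. Then the poset $\mathsf{OFilt}(L)$ of Scott-open filters of $L$, ordered by reverse inclusion, is isomorphic to the poset $\mathsf{SUp}(X)$ of S-upsets of $X$, ordered by inclusion. (The isomorphism sends a Scott-open filter $F$ to $K_F=\bigcap\{\sigma(a): a\in F\}$.)
   Context: A frame is a complete lattice $L$ with $a\wedge\bigvee S=\bigvee\{a\wedge s: s\in S\}$. The Priestley space $X$ of $L$ is the set of prime filters of $L$ ordered by inclusion, with the topology generated by the subbasis $\{\sigma(a): a\in L\}\cup\{X\setminus\sigma(b): b\in L\}$, where $\sigma(a)=\{x\in X: a\in x\}$. A filter $F$ of $L$ is Scott-open if whenever $\bigvee S\in F$, there is a finite $T\subseteq S$ with $\bigvee T\in F$. A filter is completely prime if $\bigvee S\in F$ implies $S\cap F\ne\varnothing$; let $Y\subseteq X$ be the set of completely prime filters. For $K\subseteq X$, $\min K$ denotes its set of minimal elements. An S-upset of $X$ is a closed upset $K$ of $X$ with $\min K\subseteq Y$. *)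

theory Defs
  imports "HOL-Analysis.Abstract_Topology"
begin

text \<open>The library class \<^class>\<open>complete_distrib_lattice\<close> demands complete distributivity, which is
  strictly stronger than the frame law.\<close>

class frame = complete_lattice +
  assumes inf_Sup_frame: "inf a (Sup S) = (SUP s\<in>S. inf a s)"

definition lattice_filter :: "'a::bounded_lattice set \<Rightarrow> bool" where
  "lattice_filter F \<longleftrightarrow>
     F \<noteq> {} \<and> (\<forall>a\<in>F. \<forall>b. a \<le> b \<longrightarrow> b \<in> F) \<and> (\<forall>a\<in>F. \<forall>b\<in>F. inf a b \<in> F)"

text \<open>Prime filters are proper. A Scott-open filter need not be: the improper filter
  corresponds to the empty S-upset.\<close>

definition prime_filter :: "'a::bounded_lattice set \<Rightarrow> bool" where
  "prime_filter F \<longleftrightarrow>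
     lattice_filter F \<and> F \<noteq> UNIV \<and> (\<forall>a b. sup a b \<in> F \<longrightarrow> a \<in> F \<or> b \<in> F)"

definition scott_open_filter :: "'a::complete_lattice set \<Rightarrow> bool" where
  "scott_open_filter F \<longleftrightarrow>
     lattice_filter F \<and> (\<forall>S. Sup S \<in> F \<longrightarrow> (\<exists>T. finite T \<and> T \<subseteq> S \<and> Sup T \<in> F))"

text \<open>The case \<open>S = {}\<close> makes completely prime filters proper.\<close>

definition completely_prime_filter :: "'a::complete_lattice set \<Rightarrow> bool" where
  "completely_prime_filter F \<longleftrightarrow> lattice_filter F \<and> (\<forall>S. Sup S \<in> F \<longrightarrow> S \<inter> F \<noteq> {})"

definition priestley_points :: "'a::bounded_lattice set set" where
  "priestley_points = {x. prime_filter x}"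

definition priestley_sigma :: "'a::bounded_lattice \<Rightarrow> 'a set set" where
  "priestley_sigma a = {x \<in> priestley_points. a \<in> x}"

definition priestley_topology :: "'a::bounded_lattice set topology" where
  "priestley_topology =
     topology_generated_by
       (range priestley_sigma \<union> range (\<lambda>b. priestley_points - priestley_sigma b))"

lemma topspace_priestley_topology:
  "topspace priestley_topology = (priestley_points :: 'a::bounded_lattice set set)"
  by (auto simp: priestley_topology_def priestley_sigma_def)

definition completely_prime_points :: "'a::complete_lattice set set" where
  "completely_prime_points = {x. completely_prime_filter x}"

lemma completely_prime_points_subset:
  "completely_prime_points \<subseteq> (priestley_points :: 'a::complete_lattice set set)"
proof
  fix x :: "'a set" assume "x \<in> completely_prime_points"
  then have x: "lattice_filter x" and cp: "Sup S \<in> x \<Longrightarrow> S \<inter> x \<noteq> {}" for S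
    by (auto simp: completely_prime_points_def completely_prime_filter_def)
  have "x \<noteq> UNIV" using cp[of "{}"] by auto
  moreover have "a \<in> x \<or> b \<in> x" if "sup a b \<in> x" for a b
    using cp[of "{a, b}"] that by auto
  ultimately show "x \<in> priestley_points"
    using x by (auto simp: priestley_points_def prime_filter_def)
qed

text \<open>Points are ordered by inclusion.\<close>

definition minimal_points :: "'a set set \<Rightarrow> 'a set set" where
  "minimal_points K = {x \<in> K. \<forall>y\<in>K. y \<subseteq> x \<longrightarrow> y = x}"

definition priestley_upset :: "'a::bounded_lattice set set \<Rightarrow> bool" where
  "priestley_upset K \<longleftrightarrow>
     K \<subseteq> priestley_points \<and> (\<forall>x\<in>K. \<forall>y\<in>priestley_points. x \<subseteq> y \<longrightarrow> y \<in> K)"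

definition S_upset :: "'a::complete_lattice set set \<Rightarrow> bool" where
  "S_upset K \<longleftrightarrow>
     closedin priestley_topology K \<and> priestley_upset K \<and>
     minimal_points K \<subseteq> completely_prime_points"

definition OFilt :: "'a::complete_lattice set set" where
  "OFilt = {F. scott_open_filter F}"

definition SUp :: "'a::complete_lattice set set set" where
  "SUp = {K. S_upset K}"

definition filter_upset :: "'a::bounded_lattice set \<Rightarrow> 'a set set" where
  "filter_upset F = (\<Inter>a\<in>F. priestley_sigma a)"

definition poset_isomorphism ::
  "'a set \<Rightarrow> ('a \<Rightarrow> 'a \<Rightarrow> bool) \<Rightarrow> 'b set \<Rightarrow> ('b \<Rightarrow> 'b \<Rightarrow> bool) \<Rightarrow> ('a \<Rightarrow> 'b) \<Rightarrow> bool" where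
  "poset_isomorphism A le_A B le_B f \<longleftrightarrow>
     bij_betw f A B \<and> (\<forall>x\<in>A. \<forall>y\<in>A. le_A x y \<longleftrightarrow> le_B (f x) (f y))"

end

theory Submission
  imports Defs
begin

text \<open>If \<open>x\<close> is a minimal prime filter above a Scott-open filter \<open>F\<close>, then every \<open>a \<in> x\<close> satisfies
  \<open>sup a b \<in> F\<close> for some \<open>b \<notin> x\<close>; applied to \<open>a = Sup S\<close>, Scott-openness leaves a finite
  subset of \<open>S \<union> {b}\<close> whose join is in \<open>x\<close>, so that \<open>x\<close> meets \<open>S\<close>. Conversely, by compactness, an
  S-upset \<open>K\<close> is recovered from the filter of all \<open>a\<close> with \<open>K \<subseteq> \<sigma> a\<close>, and this filter is Scott-open
  because every point of \<open>K\<close> lies above a minimal, hence completely prime, one.\<close>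

\<comment> \<open>The frame law for a two-element join is binary distributivity. It makes prime
  filter separation available in every frame.\<close>
subclass (in frame) distrib_lattice
proof
  fix x y z :: 'a
  have "inf a (sup b c) = sup (inf a b) (inf a c)" for a b c
    using inf_Sup_frame[of a "{b, c}"] by simp
  then show "sup x (inf y z) = inf (sup x y) (sup x z)"
    by (rule distrib_imp1)
qed

section \<open>Prime filters\<close>

lemma lattice_filter_up: "lattice_filter F \<Longrightarrow> a \<in> F \<Longrightarrow> a \<le> b \<Longrightarrow> b \<in> F"
  by (simp add: lattice_filter_def)

lemma lattice_filter_inf: "lattice_filter F \<Longrightarrow> a \<in> F \<Longrightarrow> b \<in> F \<Longrightarrow> inf a b \<in> F"
  by (simp add: lattice_filter_def)

lemma lattice_filter_top:
  assumes "lattice_filter F"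
  shows "top \<in> F"
proof -
  obtain a where "a \<in> F"
    using assms by (auto simp: lattice_filter_def)
  then show ?thesis
    using assms lattice_filter_up top_greatest by metis
qed

lemma prime_filter_lattice_filter: "prime_filter x \<Longrightarrow> lattice_filter x"
  by (simp add: prime_filter_def)

lemma prime_filter_top: "prime_filter x \<Longrightarrow> top \<in> x"
  by (simp add: prime_filter_def lattice_filter_top)

lemma prime_filter_bot:
  assumes "prime_filter x"
  shows "bot \<notin> x"
proof
  assume "bot \<in> x"
  then have "a \<in> x" for a
    using lattice_filter_up[OF prime_filter_lattice_filter[OF assms], of bot a] by simp
  then show False
    using assms by (auto simp: prime_filter_def)
qed

lemma prime_filter_sup_iff:
  assumes "prime_filter x"
  shows "sup a b \<in> x \<longleftrightarrow> a \<in> x \<or> b \<in> x"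
proof -
  note up = lattice_filter_up[OF prime_filter_lattice_filter[OF assms]]
  show ?thesis
    using up[of a "sup a b"] up[of b "sup a b"] assms by (auto simp: prime_filter_def)
qed

lemma prime_filter_inf_iff:
  assumes "prime_filter x"
  shows "inf a b \<in> x \<longleftrightarrow> a \<in> x \<and> b \<in> x"
proof -
  note F = prime_filter_lattice_filter[OF assms]
  show ?thesis
    using lattice_filter_up[OF F, of "inf a b" a] lattice_filter_up[OF F, of "inf a b" b]
      lattice_filter_inf[OF F, of a b] by auto
qed

lemma prime_filter_Sup_finite:
  fixes x :: "'a::complete_lattice set"
  assumes "prime_filter x" "finite T"
  shows "Sup T \<in> x \<longleftrightarrow> T \<inter> x \<noteq> {}"
  using assms(2)
proof (induction T rule: finite_induct)
  case empty
  show ?case using prime_filter_bot[OF assms(1)] by simp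
next
  case (insert a T)
  then show ?case using prime_filter_sup_iff[OF assms(1), of a "Sup T"] by auto
qed

section \<open>Separating filters from ideals by prime filters\<close>

lemma lattice_filter_adjoin:
  fixes F :: "'a::bounded_lattice set" and a :: 'a
  assumes F: "lattice_filter F"
  defines "G \<equiv> {z. \<exists>m\<in>F. inf m a \<le> z}"
  shows "lattice_filter G" "F \<subseteq> G" "a \<in> G"
proof -
  show "F \<subseteq> G" "a \<in> G"
    using lattice_filter_top[OF F] by (auto simp: G_def intro: le_infI1)
  have "inf y z \<in> G" if yz: "y \<in> G" "z \<in> G" for y z
  proof -
    obtain m n where mn: "m \<in> F" "n \<in> F" "inf m a \<le> y" "inf n a \<le> z"
      using yz by (auto simp: G_def)
    have "inf (inf m n) a \<le> inf m a" "inf (inf m n) a \<le> inf n a"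
      by (auto intro: le_infI1 le_infI2)
    then have "inf (inf m n) a \<le> inf y z"
      using mn by (meson le_infI order_trans)
    then show ?thesis
      using mn lattice_filter_inf[OF F] by (auto simp: G_def)
  qed
  moreover have "z \<in> G" if "y \<in> G" "y \<le> z" for y z
    using that by (auto simp: G_def intro: order_trans)
  ultimately show "lattice_filter G"
    using \<open>a \<in> G\<close> unfolding lattice_filter_def by blast
qed

text \<open>By Zorn there is a filter maximal among those above \<open>F\<close> that miss the ideal
  \<open>I\<close>; maximality and distributivity make it prime. The generality pays off: the result
  is applied to the frame and also to a powerset lattice.\<close>

theorem prime_filter_separation:
  fixes F I :: "'a::{bounded_lattice,distrib_lattice} set"
  assumes F: "lattice_filter F"
    and I: "I \<noteq> {}" "\<And>a b. a \<in> I \<Longrightarrow> b \<le> a \<Longrightarrow> b \<in> I" "\<And>a b. a \<in> I \<Longrightarrow> b \<in> I \<Longrightarrow> sup a b \<in> I"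
    and disj: "F \<inter> I = {}"
  obtains x where "prime_filter x" "F \<subseteq> x" "x \<inter> I = {}"
proof -
  let ?A = "{G. lattice_filter G \<and> F \<subseteq> G \<and> G \<inter> I = {}}"
  have "\<exists>M\<in>?A. \<forall>G\<in>?A. M \<subseteq> G \<longrightarrow> G = M"
  proof (rule subset_Zorn_nonempty)
    show "?A \<noteq> {}" using F disj by blast
    fix C assume C: "C \<noteq> {}" "subset.chain ?A C"
    then have C_sub: "C \<subseteq> ?A" and C_lin: "\<And>G H. G \<in> C \<Longrightarrow> H \<in> C \<Longrightarrow> G \<subseteq> H \<or> H \<subseteq> G"
      by (auto simp: subset_chain_def)
    have "inf a b \<in> \<Union>C" if ab: "a \<in> \<Union>C" "b \<in> \<Union>C" for a b
    proof -
      obtain G where "G \<in> C" "a \<in> G" "b \<in> G"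
        using ab C_lin by blast
      then show ?thesis
        using C_sub lattice_filter_inf[of G] by blast
    qed
    moreover have "b \<in> \<Union>C" if ab: "a \<in> \<Union>C" "a \<le> b" for a b
      using ab C_sub lattice_filter_up by blast
    moreover have "\<Union>C \<noteq> {}"
      using C C_sub lattice_filter_top by blast
    ultimately have "lattice_filter (\<Union>C)"
      unfolding lattice_filter_def by blast
    then show "\<Union>C \<in> ?A"
      using C C_sub by blast
  qed
  then obtain M where M: "lattice_filter M" "F \<subseteq> M" "M \<inter> I = {}"
    and max: "\<And>G. lattice_filter G \<Longrightarrow> M \<subseteq> G \<Longrightarrow> G \<inter> I = {} \<Longrightarrow> G = M"
    by (smt (verit, best) mem_Collect_eq order_trans)
  \<comment> \<open>The filter generated by \<open>M\<close> and \<open>a\<close> properly extends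
    \<open>M\<close>, so it meets \<open>I\<close>; as \<open>I\<close> is a downset, some generator
    \<open>inf m a\<close> is already in \<open>I\<close>.\<close>
  have meets: "\<exists>m\<in>M. inf m a \<in> I" if a: "a \<notin> M" for a
  proof -
    have "{z. \<exists>m\<in>M. inf m a \<le> z} \<inter> I \<noteq> {}"
      using max lattice_filter_adjoin[OF M(1), of a] a by blast
    then show ?thesis
      using I(2) by blast
  qed
  have "a \<in> M \<or> b \<in> M" if ab: "sup a b \<in> M" for a b
  proof (rule ccontr)
    assume "\<not> (a \<in> M \<or> b \<in> M)"
    then obtain m n where mn: "m \<in> M" "n \<in> M" "inf m a \<in> I" "inf n b \<in> I"
      using meets by blast
    \<comment> \<open>With the common factor \<open>inf m n\<close>, distributivity puts one element
      into both \<open>M\<close> and \<open>I\<close>.\<close>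
    have "inf (inf m n) a \<in> I" "inf (inf m n) b \<in> I"
      using mn I(2) by (meson inf_mono inf_le1 inf_le2 order_refl)+
    then have "inf (inf m n) (sup a b) \<in> I"
      by (simp add: inf_sup_distrib1 I(3))
    moreover have "inf (inf m n) (sup a b) \<in> M"
      using mn ab M(1) by (simp add: lattice_filter_inf)
    ultimately show False
      using M(3) by blast
  qed
  then have "prime_filter M"
    using M I(1) by (auto simp: prime_filter_def)
  then show thesis
    using M that by blast
qed

lemma prime_filter_extension:
  fixes F :: "'a::{bounded_lattice,distrib_lattice} set"
  assumes "lattice_filter F" "a \<notin> F"
  obtains x where "prime_filter x" "F \<subseteq> x" "a \<notin> x"
proof (rule prime_filter_separation[of F "{..a}"])
  show "F \<inter> {..a} = {}"
    using assms lattice_filter_up by fastforce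
qed (use assms that in auto)

section \<open>The Priestley space\<close>

lemma mem_priestley_points [simp]: "x \<in> priestley_points \<longleftrightarrow> prime_filter x"
  by (simp add: priestley_points_def)

lemma mem_priestley_sigma [simp]: "x \<in> priestley_sigma a \<longleftrightarrow> prime_filter x \<and> a \<in> x"
  by (simp add: priestley_sigma_def)

lemma mem_filter_upset:
  assumes "lattice_filter F"
  shows "x \<in> filter_upset F \<longleftrightarrow> prime_filter x \<and> F \<subseteq> x"
  using assms by (auto simp: filter_upset_def lattice_filter_def)

text \<open>Reduces convergence arguments to subbasic open sets. The empty set needs no case of its
  own, being the empty union.\<close>

lemma openin_priestley_induct [consumes 1, case_names Int Union sigma compl]:
  assumes "openin priestley_topology U"
    and "\<And>U V. P U \<Longrightarrow> P V \<Longrightarrow> P (U \<inter> V)"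
    and "\<And>\<U>. (\<And>U. U \<in> \<U> \<Longrightarrow> P U) \<Longrightarrow> P (\<Union>\<U>)"
    and "\<And>a. P (priestley_sigma a)"
    and "\<And>a. P (priestley_points - priestley_sigma a)"
  shows "P U"
proof -
  have "generate_topology_on
      (range priestley_sigma \<union> range (\<lambda>b. priestley_points - priestley_sigma b)) U"
    using assms(1) by (simp add: priestley_topology_def openin_topology_generated_by_iff)
  then show ?thesis
  proof (induction rule: generate_topology_on.induct)
    case Empty
    show ?case using assms(3)[of "{}"] by simp
  qed (use assms in blast)+
qed

lemma closedin_priestley_sigma: "closedin priestley_topology (priestley_sigma a)"
proof -
  have "openin priestley_topology (priestley_points - priestley_sigma a)"
    unfolding priestley_topology_def by (rule topology_generated_by_Basis) auto
  then show ?thesis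
    by (auto simp: closedin_def topspace_priestley_topology)
qed

text \<open>An ultrafilter on \<open>K\<close> is a prime filter of the powerset lattice. Without a finite subcover,
  prime filter separation gives one containing no \<open>\<sigma> a\<close> with \<open>a \<in> A\<close>, and its limit is a point
  of \<open>K\<close> that is not covered.\<close>

theorem closed_priestley_finite_subcover:
  fixes K :: "'a::bounded_lattice set set"
  assumes K: "closedin priestley_topology K"
    and cover: "K \<subseteq> (\<Union>a\<in>A. priestley_sigma a)"
  obtains T where "finite T" "T \<subseteq> A" "K \<subseteq> (\<Union>a\<in>T. priestley_sigma a)"
proof (rule ccontr)
  assume "\<not> thesis"
  then have no_sub: "\<not> K \<subseteq> (\<Union>a\<in>T. priestley_sigma a)" if "finite T" "T \<subseteq> A" for T
    using that \<open>\<And>T. finite T \<Longrightarrow> T \<subseteq> A \<Longrightarrow> K \<subseteq> (\<Union>a\<in>T. priestley_sigma a) \<Longrightarrow> thesis\<close> by blast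
  have K_points: "K \<subseteq> priestley_points"
    using closedin_subset[OF K] by (simp add: topspace_priestley_topology)
  \<comment> \<open>The ideal of sets whose trace on \<open>K\<close> is finitely covered. By
    \<open>no_sub\<close> it contains no superset of \<open>K\<close>.\<close>
  define I where "I = {Z. \<exists>T. finite T \<and> T \<subseteq> A \<and> K \<inter> Z \<subseteq> (\<Union>a\<in>T. priestley_sigma a)}"
  obtain U where U: "prime_filter U" and KU: "{Z. K \<subseteq> Z} \<subseteq> U" and UI: "U \<inter> I = {}"
  proof (rule prime_filter_separation[of "{Z. K \<subseteq> Z}" I])
    show "lattice_filter {Z. K \<subseteq> Z}"
      by (auto simp: lattice_filter_def)
    show "I \<noteq> {}"
      by (auto simp: I_def)
    show "b \<in> I" if "a \<in> I" "b \<le> a" for a b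
      using that unfolding I_def by blast
    show "sup a b \<in> I" if ab: "a \<in> I" "b \<in> I" for a b
    proof -
      obtain T T' where "finite T" "T \<subseteq> A" "K \<inter> a \<subseteq> (\<Union>a\<in>T. priestley_sigma a)"
        "finite T'" "T' \<subseteq> A" "K \<inter> b \<subseteq> (\<Union>a\<in>T'. priestley_sigma a)"
        using ab unfolding I_def by blast
      then have "finite (T \<union> T') \<and> T \<union> T' \<subseteq> A \<and> K \<inter> sup a b \<subseteq> (\<Union>a\<in>T \<union> T'. priestley_sigma a)"
        by auto
      then show ?thesis
        unfolding I_def by blast
    qed
    show "{Z. K \<subseteq> Z} \<inter> I = {}"
      using no_sub by (auto simp: I_def inf.absorb1)
  qed
  have U_filter: "lattice_filter U"
    using U by (simp add: prime_filter_def)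
  \<comment> \<open>Since \<open>K\<close> itself is in \<open>U\<close>, only traces on
    \<open>K\<close> matter.\<close>
  have U_mono: "W \<in> U" if "V \<in> U" "V \<inter> K \<subseteq> W" for V W
  proof -
    have "V \<inter> K \<in> U"
      using that KU U by (auto simp: prime_filter_inf_iff)
    then show ?thesis
      using that lattice_filter_up[OF U_filter] by blast
  qed
  have U_compl: "- V \<in> U \<longleftrightarrow> V \<notin> U" for V
  proof -
    have "V \<union> - V \<in> U" "V \<inter> - V \<notin> U"
      using lattice_filter_top[OF U_filter] prime_filter_bot[OF U] by auto
    then show ?thesis
      using U prime_filter_sup_iff prime_filter_inf_iff by blast
  qed
  \<comment> \<open>The limit of \<open>U\<close>. On traces in \<open>K\<close>,
    \<open>priestley_sigma\<close> preserves finite meets and joins, so the preimage of the prime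
    filter \<open>U\<close> is prime.\<close>
  define x where "x = {a. priestley_sigma a \<in> U}"
  have sigma_inf: "priestley_sigma (inf a b) = priestley_sigma a \<inter> priestley_sigma b"
    and sigma_sup: "priestley_sigma (sup a b) = priestley_sigma a \<union> priestley_sigma b" for a b :: 'a
    by (auto simp: prime_filter_inf_iff prime_filter_sup_iff)
  have "K \<subseteq> priestley_sigma top"
    using K_points by (auto simp: prime_filter_top)
  then have "top \<in> x"
    using KU by (auto simp: x_def)
  moreover have "priestley_sigma bot = ({} :: 'a set set)"
    by (auto simp: prime_filter_bot)
  then have "bot \<notin> x"
    using prime_filter_bot[OF U] by (simp add: x_def)
  moreover have "b \<in> x" if "a \<in> x" "a \<le> b" for a b
  proof -
    have "priestley_sigma a \<subseteq> priestley_sigma b"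
      using sigma_inf[of a b] that(2) by (simp add: inf.absorb1 inf.absorb_iff1)
    then show ?thesis
      using that(1) U_mono[of "priestley_sigma a"] by (auto simp: x_def)
  qed
  moreover have "inf a b \<in> x" if "a \<in> x" "b \<in> x" for a b
    using that U by (simp add: x_def sigma_inf prime_filter_inf_iff)
  moreover have "a \<in> x \<or> b \<in> x" if "sup a b \<in> x" for a b
    using that U by (simp add: x_def sigma_sup prime_filter_sup_iff)
  ultimately have x: "prime_filter x"
    unfolding prime_filter_def lattice_filter_def by blast
  \<comment> \<open>\<open>U\<close> converges to \<open>x\<close>: for
    \<open>priestley_sigma a\<close> this is the definition of \<open>x\<close>, for complements it
    is the ultrafilter property \<open>U_compl\<close>.\<close>
  have conv: "x \<in> W \<Longrightarrow> W \<in> U" if "openin priestley_topology W" for W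
    using that
  proof (induction rule: openin_priestley_induct)
    case (Int V W)
    then show ?case using U by (simp add: prime_filter_inf_iff)
  next
    case (Union \<U>)
    then obtain V where "V \<in> \<U>" "V \<in> U" by blast
    then show ?case using U_mono by blast
  next
    case (sigma a)
    then show ?case by (simp add: x_def)
  next
    case (compl a)
    then have "- priestley_sigma a \<in> U"
      using U_compl by (simp add: x_def x)
    then show ?case
      using K_points by (rule_tac U_mono) auto
  qed
  have "x \<in> K"
  proof (rule ccontr)
    assume "x \<notin> K"
    moreover have "openin priestley_topology (priestley_points - K)"
      using K by (simp add: closedin_def topspace_priestley_topology)
    ultimately have "priestley_points - K \<in> U"
      using conv x by simp
    \<comment> \<open>The set \<open>priestley_points - K\<close> has empty trace on
      \<open>K\<close>.\<close>
    then have "{} \<in> U"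
      using U_mono by blast
    then show False
      using prime_filter_bot[OF U] by simp
  qed
  then obtain a where a: "a \<in> A" "priestley_sigma a \<in> U"
    using cover by (auto simp: x_def)
  then have "priestley_sigma a \<in> I"
    unfolding I_def by (intro CollectI exI[of _ "{a}"]) auto
  with a UI show False by blast
qed

section \<open>Minimal points of closed sets\<close>

text \<open>The intersection of a chain of prime filters is prime, and it is the topological limit
  of the chain taken downwards, so a closed set containing the chain contains it.\<close>

lemma closed_priestley_chain_Inter:
  assumes K: "closedin priestley_topology K"
    and C: "C \<noteq> {}" "C \<subseteq> K" "\<And>x y. x \<in> C \<Longrightarrow> y \<in> C \<Longrightarrow> x \<subseteq> y \<or> y \<subseteq> x"
  shows "\<Inter>C \<in> K"
proof (rule ccontr)
  assume notin: "\<Inter>C \<notin> K"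
  have prime: "prime_filter x" if "x \<in> C" for x
    using closedin_subset[OF K] C(2) that by (auto simp: topspace_priestley_topology)
  have "lattice_filter (\<Inter>C)"
  proof -
    have "top \<in> \<Inter>C"
      using prime by (simp add: prime_filter_top)
    then show ?thesis
      using prime unfolding lattice_filter_def prime_filter_def by blast
  qed
  moreover have "\<Inter>C \<noteq> UNIV"
    using C(1) prime unfolding prime_filter_def by blast
  moreover have "a \<in> \<Inter>C \<or> b \<in> \<Inter>C" if ab: "sup a b \<in> \<Inter>C" for a b
  proof (rule ccontr)
    assume "\<not> (a \<in> \<Inter>C \<or> b \<in> \<Inter>C)"
    \<comment> \<open>One member of the chain omits \<open>a\<close> and one omits \<open>b\<close>;
      the smaller of the two omits both.\<close>
    then obtain x where "x \<in> C" "a \<notin> x" "b \<notin> x"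
      using C(3) by blast
    then show False
      using ab prime prime_filter_sup_iff by blast
  qed
  ultimately have p: "prime_filter (\<Inter>C)"
    by (simp add: prime_filter_def)
  \<comment> \<open>Every neighbourhood of the intersection contains a lower end of the chain: an
    element of the intersection is in all members, and an element omitted by one member is omitted
    by all smaller ones.\<close>
  have near: "\<Inter>C \<in> U \<Longrightarrow> \<exists>x\<in>C. \<forall>y\<in>C. y \<subseteq> x \<longrightarrow> y \<in> U" if "openin priestley_topology U" for U
    using that
  proof (induction rule: openin_priestley_induct)
    case (Int U V)
    then obtain x y where xy: "x \<in> C" "y \<in> C" "\<forall>z\<in>C. z \<subseteq> x \<longrightarrow> z \<in> U" "\<forall>z\<in>C. z \<subseteq> y \<longrightarrow> z \<in> V"
      by blast
    show ?case
    proof (cases "x \<subseteq> y")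
      case True
      then show ?thesis using xy by (intro bexI[of _ x]) auto
    next
      case False
      then show ?thesis using xy C(3)[of x y] by (intro bexI[of _ y]) auto
    qed
  next
    case (Union \<U>)
    then obtain V where "V \<in> \<U>" "\<exists>x\<in>C. \<forall>y\<in>C. y \<subseteq> x \<longrightarrow> y \<in> V" by blast
    then show ?case by blast
  next
    case (sigma a)
    then show ?case using C(1) prime by auto
  next
    case (compl a)
    then obtain x where "x \<in> C" "a \<notin> x" using p by auto
    then show ?case using prime by auto
  qed
  have "openin priestley_topology (priestley_points - K)"
    using K by (simp add: closedin_def topspace_priestley_topology)
  from near[OF this] obtain x where "x \<in> C" "x \<notin> K"
    using p notin by auto
  then show False
    using C(2) by blast
qed

lemma closed_priestley_minimal_below:
  assumes K: "closedin priestley_topology K" and x: "x \<in> K"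
  obtains y where "y \<in> minimal_points K" "y \<subseteq> x"
proof -
  \<comment> \<open>Complements reverse inclusion, so the maximal element given by Zorn yields a
    minimal point.\<close>
  let ?A = "uminus ` {y \<in> K. y \<subseteq> x}"
  have "\<exists>M\<in>?A. \<forall>Z\<in>?A. M \<subseteq> Z \<longrightarrow> Z = M"
  proof (rule subset_Zorn_nonempty)
    show "?A \<noteq> {}" using x by blast
    fix C assume C: "C \<noteq> {}" "subset.chain ?A C"
    then have C_sub: "C \<subseteq> ?A" and C_lin: "\<And>G H. G \<in> C \<Longrightarrow> H \<in> C \<Longrightarrow> G \<subseteq> H \<or> H \<subseteq> G"
      by (auto simp: subset_chain_def)
    have "\<Inter>(uminus ` C) \<in> K"
    proof (rule closed_priestley_chain_Inter[OF K])
      show "uminus ` C \<noteq> {}" "uminus ` C \<subseteq> K"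
        using C(1) C_sub by auto
      show "u \<subseteq> v \<or> v \<subseteq> u" if "u \<in> uminus ` C" "v \<in> uminus ` C" for u v
        using that C_lin by (metis Compl_subset_Compl_iff imageE)
    qed
    moreover have "\<Inter>(uminus ` C) \<subseteq> x"
      using C C_sub by blast
    moreover have "\<Union>C = - \<Inter>(uminus ` C)"
      by auto
    ultimately show "\<Union>C \<in> ?A"
      by blast
  qed
  then obtain y where y: "y \<in> K" "y \<subseteq> x" and "\<forall>z. z \<in> K \<and> z \<subseteq> x \<longrightarrow> z \<subseteq> y \<longrightarrow> z = y"
    by (elim bexE imageE) auto
  then have "y \<in> minimal_points K"
    using y by (auto simp: minimal_points_def)
  then show thesis
    using y that by blast
qed

section \<open>Scott-open filters and S-upsets\<close>

text \<open>Otherwise \<open>F\<close> misses the ideal generated by \<open>a\<close> and the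
  complement of \<open>x\<close>. A prime filter above \<open>F\<close> missing that ideal lies
  inside \<open>x\<close> and omits \<open>a\<close>, contradicting minimality.\<close>

lemma minimal_prime_filter_witness:
  fixes F :: "'a::{bounded_lattice,distrib_lattice} set"
  assumes F: "lattice_filter F" and x: "x \<in> minimal_points (filter_upset F)" and a: "a \<in> x"
  obtains b where "b \<notin> x" "sup a b \<in> F"
proof (rule ccontr)
  assume "\<not> thesis"
  then have no_b: "sup a b \<notin> F" if "b \<notin> x" for b
    using that \<open>\<And>b. b \<notin> x \<Longrightarrow> sup a b \<in> F \<Longrightarrow> thesis\<close> by blast
  let ?I = "{z. \<exists>b. b \<notin> x \<and> z \<le> sup a b}"
  have prime: "prime_filter x" and Fx: "F \<subseteq> x"
    using x by (auto simp: minimal_points_def mem_filter_upset[OF F])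
  obtain y where y: "prime_filter y" "F \<subseteq> y" "y \<inter> ?I = {}"
  proof (rule prime_filter_separation[OF F, of ?I])
    have "bot \<in> ?I"
      using prime_filter_bot[OF prime] by auto
    then show "?I \<noteq> {}" by blast
    show "v \<in> ?I" if "u \<in> ?I" "v \<le> u" for u v
      using that order_trans by blast
    show "sup u v \<in> ?I" if uv: "u \<in> ?I" "v \<in> ?I" for u v
    proof -
      obtain b c where "b \<notin> x" "c \<notin> x" "u \<le> sup a b" "v \<le> sup a c"
        using uv by blast
      then have "sup b c \<notin> x \<and> sup u v \<le> sup a (sup b c)"
        using prime by (simp add: prime_filter_sup_iff) (meson le_sup_iff order_trans sup_ge1 sup_ge2)
      then show ?thesis by blast
    qed
    show "F \<inter> ?I = {}"
      using no_b lattice_filter_up[OF F] by blast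
  qed
  have "z \<in> ?I" if "z \<notin> x" for z
    using that sup_ge2 by blast
  then have "y \<subseteq> x"
    using y(3) by blast
  moreover have "y \<in> filter_upset F"
    using y by (simp add: mem_filter_upset[OF F])
  ultimately have "y = x"
    using x by (simp add: minimal_points_def)
  moreover have "a \<in> ?I"
    using prime_filter_bot[OF prime] sup_ge1 by blast
  ultimately show False
    using y(3) a by blast
qed

lemma S_upset_filter_upset:
  fixes F :: "'a::frame set"
  assumes "scott_open_filter F"
  shows "S_upset (filter_upset F)"
proof -
  have F: "lattice_filter F"
    and scott: "\<And>S. Sup S \<in> F \<Longrightarrow> \<exists>T. finite T \<and> T \<subseteq> S \<and> Sup T \<in> F"
    using assms by (auto simp: scott_open_filter_def)
  \<comment> \<open>Filters are nonempty, so this is an intersection over a nonempty family of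
    closed sets.\<close>
  have "closedin priestley_topology (filter_upset F)"
    unfolding filter_upset_def
    using F by (intro closedin_Inter) (auto simp: closedin_priestley_sigma lattice_filter_def)
  moreover have "priestley_upset (filter_upset F)"
    by (auto simp: priestley_upset_def mem_filter_upset[OF F] subset_iff)
  moreover have "completely_prime_filter x" if x: "x \<in> minimal_points (filter_upset F)" for x
  proof -
    have prime: "prime_filter x" and Fx: "F \<subseteq> x"
      using x by (auto simp: minimal_points_def mem_filter_upset[OF F])
    have "S \<inter> x \<noteq> {}" if S: "Sup S \<in> x" for S
    proof -
      obtain b where b: "b \<notin> x" "sup (Sup S) b \<in> F"
        using minimal_prime_filter_witness[OF F x S] .
      \<comment> \<open>Absorbing \<open>b\<close> into the family lets Scott-openness apply; as
        \<open>b\<close> is not in \<open>x\<close>, the element of \<open>T\<close> found in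
        \<open>x\<close> must come from \<open>S\<close>.\<close>
      then have "Sup (insert b S) \<in> F"
        by (simp add: sup_commute)
      then obtain T where T: "finite T" "T \<subseteq> insert b S" "Sup T \<in> F"
        using scott by blast
      then have "T \<inter> x \<noteq> {}"
        using prime_filter_Sup_finite[OF prime] Fx by blast
      then show ?thesis
        using T b by blast
    qed
    then show ?thesis
      using prime by (simp add: completely_prime_filter_def prime_filter_def)
  qed
  ultimately show ?thesis
    by (auto simp: S_upset_def completely_prime_points_def)
qed

section \<open>Recovering an S-upset from its filter\<close>

text \<open>\<open>priestley_sigma\<close> turns finite joins into unions, so a finite subcover
  collapses to a single basic set.\<close>

lemma closed_cover_Sup:
  fixes K :: "'a::complete_lattice set set"
  assumes K: "closedin priestley_topology K" and cover: "K \<subseteq> (\<Union>a\<in>A. priestley_sigma a)"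
  obtains T where "finite T" "T \<subseteq> A" "K \<subseteq> priestley_sigma (Sup T)"
proof -
  obtain T where "finite T" "T \<subseteq> A" "K \<subseteq> (\<Union>a\<in>T. priestley_sigma a)"
    using closed_priestley_finite_subcover[OF K cover] .
  moreover from this have "K \<subseteq> priestley_sigma (Sup T)"
    by (fastforce simp: prime_filter_Sup_finite)
  ultimately show thesis
    using that by blast
qed

text \<open>\<open>\<Inter>K\<close> consists of all \<open>a\<close> with
  \<open>K \<subseteq> priestley_sigma a\<close>. Compactness separates each prime filter
  \<open>z\<close> outside \<open>K\<close> from \<open>K\<close> by one such \<open>a\<close> not
  in \<open>z\<close>.\<close>

lemma filter_upset_Inter:
  fixes K :: "'a::complete_lattice set set"
  assumes K: "closedin priestley_topology K" and up: "priestley_upset K"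
    and F: "lattice_filter (\<Inter>K)"
  shows "filter_upset (\<Inter>K) = K"
proof
  have K_prime: "prime_filter x" if "x \<in> K" for x
    using up that by (auto simp: priestley_upset_def)
  show "K \<subseteq> filter_upset (\<Inter>K)"
    using K_prime by (auto simp: mem_filter_upset[OF F])
  show "filter_upset (\<Inter>K) \<subseteq> K"
  proof
    fix z assume "z \<in> filter_upset (\<Inter>K)"
    then have z: "prime_filter z" "\<Inter>K \<subseteq> z"
      by (auto simp: mem_filter_upset[OF F])
    show "z \<in> K"
    proof (rule ccontr)
      assume "z \<notin> K"
      \<comment> \<open>As \<open>K\<close> is an upset without \<open>z\<close>, no point of
        \<open>K\<close> lies below \<open>z\<close>, so each contains an element outside
        \<open>z\<close>.\<close>
      have "K \<subseteq> (\<Union>a\<in>- z. priestley_sigma a)"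
      proof
        fix x assume x: "x \<in> K"
        then have "\<not> x \<subseteq> z"
          using up z(1) \<open>z \<notin> K\<close> by (auto simp: priestley_upset_def)
        then show "x \<in> (\<Union>a\<in>- z. priestley_sigma a)"
          using K_prime[OF x] by auto
      qed
      then obtain T where T: "finite T" "T \<subseteq> - z" "K \<subseteq> priestley_sigma (Sup T)"
        by (rule closed_cover_Sup[OF K])
      then have "Sup T \<in> \<Inter>K"
        by auto
      then have "Sup T \<in> z"
        using z(2) by (rule rev_subsetD)
      then show False
        using T prime_filter_Sup_finite[OF z(1)] by blast
    qed
  qed
qed

lemma scott_open_filter_Inter:
  fixes K :: "'a::complete_lattice set set"
  assumes "S_upset K"
  shows "scott_open_filter (\<Inter>K)"
proof -
  have K: "closedin priestley_topology K"
    and min: "minimal_points K \<subseteq> completely_prime_points"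
    and K_prime: "\<And>x. x \<in> K \<Longrightarrow> prime_filter x"
    using assms by (auto simp: S_upset_def priestley_upset_def)
  \<comment> \<open>This includes empty \<open>K\<close>, where \<open>\<Inter>K\<close> is the
    improper filter \<open>UNIV\<close>.\<close>
  have "top \<in> \<Inter>K"
    using K_prime by (simp add: prime_filter_top)
  then have "lattice_filter (\<Inter>K)"
    using K_prime unfolding lattice_filter_def prime_filter_def by blast
  moreover have "\<exists>T. finite T \<and> T \<subseteq> S \<and> Sup T \<in> \<Inter>K" if S: "Sup S \<in> \<Inter>K" for S
  proof -
    have "K \<subseteq> (\<Union>a\<in>S. priestley_sigma a)"
    proof
      fix x assume x: "x \<in> K"
      obtain y where y: "y \<in> minimal_points K" "y \<subseteq> x"
        using closed_priestley_minimal_below[OF K x] .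
      then have "completely_prime_filter y" "Sup S \<in> y"
        using min S by (auto simp: completely_prime_points_def minimal_points_def)
      then have "S \<inter> x \<noteq> {}"
        using y unfolding completely_prime_filter_def by blast
      then show "x \<in> (\<Union>a\<in>S. priestley_sigma a)"
        using K_prime[OF x] by auto
    qed
    then obtain T where "finite T" "T \<subseteq> S" "K \<subseteq> priestley_sigma (Sup T)"
      using closed_cover_Sup[OF K] by blast
    then show ?thesis
      by (intro exI[of _ T]) auto
  qed
  ultimately show ?thesis
    by (simp add: scott_open_filter_def)
qed

section \<open>The order isomorphism\<close>

text \<open>The order is reflected because a filter in a distributive lattice is the intersection of
  the prime filters above it.\<close>

lemma filter_upset_subset_iff:
  fixes F G :: "'a::{bounded_lattice,distrib_lattice} set"
  assumes F: "lattice_filter F" and G: "lattice_filter G"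
  shows "filter_upset F \<subseteq> filter_upset G \<longleftrightarrow> G \<subseteq> F"
proof
  assume sub: "filter_upset F \<subseteq> filter_upset G"
  show "G \<subseteq> F"
  proof (rule ccontr)
    assume "\<not> G \<subseteq> F"
    then obtain a where a: "a \<in> G" "a \<notin> F" by blast
    obtain x where x: "prime_filter x" "F \<subseteq> x" "a \<notin> x"
      using prime_filter_extension[OF F a(2)] .
    then have "x \<in> filter_upset F"
      by (simp add: mem_filter_upset[OF F])
    with sub have "x \<in> filter_upset G"
      by (rule subsetD)
    then have "G \<subseteq> x"
      by (simp add: mem_filter_upset[OF G])
    then show False
      using a(1) x(3) by blast
  qed
qed (auto simp: filter_upset_def)

theorem theorem5p6:
  shows "poset_isomorphism (OFilt :: 'a::frame set set) (\<supseteq>) (SUp :: 'a set set set) (\<subseteq>) filter_upset"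
proof -
  have order: "filter_upset F \<subseteq> filter_upset G \<longleftrightarrow> G \<subseteq> F" if "F \<in> OFilt" "G \<in> OFilt" for F G :: "'a set"
    using that filter_upset_subset_iff by (auto simp: OFilt_def scott_open_filter_def)
  \<comment> \<open>Reflecting the order already gives injectivity, by antisymmetry of
    inclusion.\<close>
  have "inj_on filter_upset (OFilt :: 'a set set)"
    using order by (intro inj_onI) blast
  moreover have "filter_upset ` OFilt \<subseteq> (SUp :: 'a set set set)"
    using S_upset_filter_upset by (auto simp: OFilt_def SUp_def)
  moreover have "K \<in> filter_upset ` OFilt" if "K \<in> SUp" for K :: "'a set set"
  proof (rule image_eqI)
    have K: "S_upset K"
      using that by (simp add: SUp_def)
    from scott_open_filter_Inter[OF this] show "\<Inter>K \<in> OFilt"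
      by (simp add: OFilt_def)
    then show "K = filter_upset (\<Inter>K)"
      using K filter_upset_Inter[of K] by (simp add: S_upset_def OFilt_def scott_open_filter_def)
  qed
  ultimately show ?thesis
    using order by (auto simp: poset_isomorphism_def bij_betw_def)
qed

end
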